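(* Let $A$ be an infinite subset of $\mathbb{N}$, let $n_0$ be such that $r(A,n)\neq 1$ for all $n\ge n_0$, and let $a_0\in A$ with $a_0\ge n_0$. Then for all sufficiently large $x$ the following holds: if $$|A(x)|\le \left(\frac{\log x}{\log\log x}\right)^2$$ and $b$ is a real number with $$a_0\le b\le \frac{x}{(\log x)^2},$$ then there exists $a\in A$ with $a>3b$ and $a+b<x$ such that $$[a-b,a)\cap A=\emptyset \quad\text{and}\quad |(b,a+b]\cap A|\ge \frac{a+b}{2b}-1.$$
   Context: $\mathbb{N}$ is the set of all natural numbers. For a set $A\subseteq\mathbb{N}$ and $n\in\mathbb{N}$, $r(A,n)$ denotes the number of solutions of the equation $n=a+b$ with $a,b\in A$ and $a\le b$. For real $x$, $A(x)$ is the set of integers in $A$ that are less than or equal to $x$, and $|A(x)|$ is its cardinality. $\log$ is the natural logarithm. Intervals are intervals of real numbers. "Sufficiently large $x$" means all real $x\ge x_0$ for some threshold $x_0$ that may depend on $A$, $n_0$ and $a_0$ but not on $b$. *)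

theory Defs
  imports Complex_Main
begin

text \<open>
  The natural numbers are taken to include \<open>0\<close>; sets of positive integers are
  the special case \<open>0 \<notin> A\<close>.
\<close>

definition rep_count :: "nat set \<Rightarrow> nat \<Rightarrow> nat" where
  "rep_count A n = card {(a, b). a \<in> A \<and> b \<in> A \<and> a \<le> b \<and> n = a + b}"

definition elems_upto :: "nat set \<Rightarrow> real \<Rightarrow> nat set" where
  "elems_upto A x = {a \<in> A. real a \<le> x}"

end

theory Submission
  imports Defs
begin

text \<open>
  Since \<open>2p\<close> has a second representation for \<open>p \<in> A\<close>, \<open>p \<ge> n\<^sub>0\<close>, the element of \<open>A\<close>
  following \<open>p\<close> is at most \<open>2p\<close>. Take \<open>a\<close> to be the least element of \<open>A\<close> above \<open>3b\<close> that is
  preceded by a gap of length \<open>b\<close>, and let \<open>p\<close> be its predecessor. Below \<open>a\<close> the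
  gaps are short, so walking down from \<open>p\<close> in steps of length at most \<open>b\<close> yields at least
  \<open>p/b - 2\<close> elements in \<open>(2b, p]\<close>; together with \<open>a\<close> and an element in \<open>(b, 2b]\<close> this gives
  \<open>p/b \<ge> a/(2b)\<close> elements. If no such \<open>a\<close> existed below \<open>x - b\<close>, the same walk would start near
  \<open>x/2\<close> and give about \<open>x/(2b) \<ge> (log x)\<^sup>2/2\<close> elements, which is too many.
\<close>

text \<open>The pair \<open>(s, s)\<close> always represents \<open>2 * s\<close>, so a count other
  than 1 forces a different pair, whose larger entry exceeds \<open>s\<close>.\<close>

lemma next_element_le_double:
  fixes A :: "nat set"
  assumes "s \<in> A" "rep_count A (2 * s) \<noteq> 1"
  obtains d where "d \<in> A" "s < d" "d \<le> 2 * s"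
proof -
  let ?R = "{(a, b). a \<in> A \<and> b \<in> A \<and> a \<le> b \<and> 2 * s = a + b}"
  have "?R \<noteq> {(s, s)}"
    using assms(2) unfolding rep_count_def by force
  moreover have "(s, s) \<in> ?R"
    using assms(1) by simp
  ultimately obtain c d where "(c, d) \<in> ?R" "(c, d) \<noteq> (s, s)"
    by (metis (no_types, lifting) insertI1 singletonD subsetI subset_antisym subset_singletonD
        empty_iff surj_pair)
  then have "d \<in> A" "s < d" "d \<le> 2 * s"
    by auto
  then show ?thesis by (rule that)
qed

lemma finite_nats_in_real_interval:
  "finite ({u<..v::real} \<inter> real ` A)"
proof -
  have "{u<..v} \<inter> real ` A \<subseteq> real ` {..nat \<lfloor>v\<rfloor>}"
    by (auto simp: le_nat_floor)
  then show ?thesis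
    by (rule finite_subset) simp
qed

text \<open>The witness \<open>d\<close> gives \<open>y < 2 * p\<close>, so the last element up to
  \<open>y\<close> is more than \<open>y / 2\<close>. Since \<open>a0\<close> lies below
  \<open>y\<close>, this element is at least \<open>n0\<close>.\<close>

lemma last_element_upto:
  fixes A :: "nat set" and y :: real
  assumes rep: "\<forall>n\<ge>n0. rep_count A n \<noteq> 1" and "a0 \<in> A" "a0 \<ge> n0" "real a0 \<le> y"
  obtains p d where "p \<in> A" "real p \<le> y" "\<And>s. s \<in> A \<Longrightarrow> real s \<le> y \<Longrightarrow> s \<le> p"
    "d \<in> A" "y < real d" "d \<le> 2 * p"
proof -
  define B where "B = {s \<in> A. real s \<le> y}"
  have "B \<subseteq> {..nat \<lfloor>y\<rfloor>}"
    by (auto simp: B_def le_nat_floor)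
  then have fin: "finite B"
    by (rule finite_subset) simp
  have a0: "a0 \<in> B"
    using assms by (simp add: B_def)
  define p where "p = Max B"
  have p: "p \<in> B"
    unfolding p_def using fin a0 by (intro Max_in) auto
  have max: "s \<le> p" if "s \<in> A" "real s \<le> y" for s
    unfolding p_def using fin that by (intro Max_ge) (auto simp: B_def)
  have "a0 \<le> p"
    using max assms by blast
  then have "rep_count A (2 * p) \<noteq> 1"
    using rep assms(3) by simp
  then obtain d where d: "d \<in> A" "p < d" "d \<le> 2 * p"
    using next_element_le_double p by (auto simp: B_def)
  have "y < real d"
    using max[of d] d by force
  then show ?thesis
    using that[of p d] p max d by (simp add: B_def)
qed

text \<open>Each step down costs one element and lowers \<open>s / b\<close> by at most 1. The walk
  ends in \<open>(2b, 3b]\<close>, where \<open>s / b - 2\<close> is at most 1 and \<open>s\<close>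
  itself is counted.\<close>

lemma card_ge_of_short_gaps:
  fixes A :: "nat set" and b T :: real
  assumes "b > 0"
    and gaps: "\<And>s. s \<in> A \<Longrightarrow> 3 * b < real s \<Longrightarrow> real s < T \<Longrightarrow>
      {real s - b..<real s} \<inter> real ` A \<noteq> {}"
    and "s \<in> A" "2 * b < real s" "real s < T"
  shows "real (card ({2 * b<..real s} \<inter> real ` A)) \<ge> real s / b - 2"
  using assms(3-)
proof (induction s rule: less_induct)
  case (less s)
  let ?C = "\<lambda>s. {2 * b<..real s} \<inter> real ` A"
  show ?case
  proof (cases "real s \<le> 3 * b")
    case True
    have "card {real s} \<le> card (?C s)"
      using less.prems by (intro card_mono finite_nats_in_real_interval) auto
    moreover have "real s / b \<le> 3"
      using True \<open>b > 0\<close> by (simp add: divide_simps)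
    ultimately show ?thesis by simp
  next
    case False
    \<comment> \<open>As \<open>s\<close> exceeds \<open>3 * b\<close>, \<open>t\<close> stays above
      \<open>2 * b\<close>, so the induction hypothesis applies to it.\<close>
    then obtain t where t: "t \<in> A" "real s - b \<le> real t" "t < s"
      using gaps[of s] less.prems by fastforce
    have "card (insert (real s) (?C t)) \<le> card (?C s)"
      using less.prems t by (intro card_mono finite_nats_in_real_interval) auto
    then have "card (?C t) + 1 \<le> card (?C s)"
      using t by (simp add: finite_nats_in_real_interval)
    moreover have "real (card (?C t)) \<ge> real t / b - 2"
      using t False less.prems by (intro less.IH) auto
    moreover have "real t / b \<ge> real s / b - 1"
      using divide_right_mono[OF t(2), of b] \<open>b > 0\<close> by (simp add: diff_divide_distrib)
    ultimately show ?thesis by linarith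
  qed
qed

theorem lemma2p2:
  fixes A :: "nat set" and n0 a0 :: nat
  assumes "infinite A"
    and "\<forall>n\<ge>n0. rep_count A n \<noteq> 1"
    and "a0 \<in> A" and "a0 \<ge> n0"
  shows "\<forall>\<^sub>F x :: real in at_top.
    real (card (elems_upto A x)) \<le> (ln x / ln (ln x))\<^sup>2 \<longrightarrow>
    (\<forall>b :: real. real a0 \<le> b \<and> b \<le> x / (ln x)\<^sup>2 \<longrightarrow>
      (\<exists>a\<in>A. real a > 3 * b \<and> real a + b < x \<and>
        {real a - b..<real a} \<inter> real ` A = {} \<and>
        real (card ({b<..real a + b} \<inter> real ` A)) \<ge> (real a + b) / (2 * b) - 1))"
proof -
  note last = last_element_upto[OF assms(2-4)]
  \<comment> \<open>If \<open>a0\<close> were 0, the cut-off 0 would yield \<open>d\<close> with 0 <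
    \<open>d\<close> \<le> 0.\<close>
  have "a0 > 0"
    using last[of "real a0"] by (metis gr0I le_zero_eq mult_0_right of_nat_0 less_irrefl order_refl of_nat_le_0_iff)
  have "eventually (\<lambda>x::real. ln (ln x) \<ge> 2) at_top"
    by (rule eventually_compose_filterlim[OF _ filterlim_compose[OF ln_at_top ln_at_top]])
      (rule eventually_ge_at_top)
  moreover have "eventually (\<lambda>x::real. ln x \<ge> 4) at_top"
    by (rule eventually_compose_filterlim[OF _ ln_at_top]) (rule eventually_ge_at_top)
  ultimately show ?thesis
  proof (eventually_elim, intro impI allI, elim conjE)
    fix x b :: real
    assume lnln: "ln (ln x) \<ge> 2" and ln4: "ln x \<ge> 4"
      and card_A: "real (card (elems_upto A x)) \<le> (ln x / ln (ln x))\<^sup>2"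
      and b: "real a0 \<le> b" "b \<le> x / (ln x)\<^sup>2"
    have "b > 0"
      using b \<open>a0 > 0\<close> by linarith
    have ln_sq: "(ln x)\<^sup>2 \<ge> 16"
      using power_mono[OF ln4, of 2] by simp
    have "b * (ln x)\<^sup>2 \<le> x"
      using b(2) ln4 by (simp add: pos_le_divide_eq)
    then have xb: "x / b \<ge> (ln x)\<^sup>2"
      using \<open>b > 0\<close> by (simp add: pos_le_divide_eq mult.commute)
    then have x16: "x \<ge> 16 * b"
      using \<open>b > 0\<close> ln_sq by (simp flip: pos_le_divide_eq)
    define P where "P = (\<lambda>a. a \<in> A \<and> 3 * b < real a \<and> {real a - b..<real a} \<inter> real ` A = {})"
    have "\<exists>a. P a \<and> real a < x - b"
    proof (rule ccontr)
      assume "\<not> ?thesis"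
      then have gaps: "{real s - b..<real s} \<inter> real ` A \<noteq> {}"
        if "s \<in> A" "3 * b < real s" "real s < x - b" for s
        using that by (auto simp: P_def)
      \<comment> \<open>The cut-off \<open>x - 2 * b\<close> keeps \<open>s\<close> strictly below
        \<open>x - b\<close>. With \<open>L = (ln x)\<^sup>2\<close>, the walk from \<open>s\<close>
        gives at least \<open>L / 2 - 3\<close> elements against at most \<open>L / 4\<close>, which
        is impossible for \<open>L\<close> \<ge> 16.\<close>
      have "real a0 \<le> x - 2 * b"
        using b x16 \<open>b > 0\<close> by linarith
      then obtain s d where s: "s \<in> A" "real s \<le> x - 2 * b" "x - 2 * b < real d" "d \<le> 2 * s"
        using last by metis
      then have s2: "real s \<ge> (x - 2 * b) / 2"
        using of_nat_mono[OF s(4), where 'a = real] by simp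
      have "real s / b - 2 \<le> real (card ({2 * b<..real s} \<inter> real ` A))"
        using s s2 x16 \<open>b > 0\<close> by (intro card_ge_of_short_gaps[OF \<open>b > 0\<close> gaps]) auto
      also have "card ({2 * b<..real s} \<inter> real ` A) \<le> card (real ` elems_upto A x)"
      proof (rule card_mono)
        have "elems_upto A x \<subseteq> {..nat \<lfloor>x\<rfloor>}"
          by (auto simp: elems_upto_def le_nat_floor)
        then show "finite (real ` elems_upto A x)"
          by (rule finite_imageI[OF finite_subset]) simp
        show "{2 * b<..real s} \<inter> real ` A \<subseteq> real ` elems_upto A x"
          using s(2) \<open>b > 0\<close> by (auto simp: elems_upto_def)
      qed
      also have "card (real ` elems_upto A x) = card (elems_upto A x)"
        by (rule card_image) simp
      finally have "real s / b - 2 \<le> (ln x / ln (ln x))\<^sup>2"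
        using card_A by simp
      also have "\<dots> \<le> (ln x / 2)\<^sup>2"
        using lnln ln4 by (intro power_mono divide_left_mono) auto
      finally have "real s / b - 2 \<le> (ln x)\<^sup>2 / 4"
        by (simp add: power_divide)
      moreover have "2 * (real s / b) \<ge> x / b - 2"
        using divide_right_mono[OF s2, of b] \<open>b > 0\<close> by (simp add: diff_divide_distrib)
      ultimately show False
        using xb ln_sq by linarith
    qed
    then obtain a' where a': "P a'" "real a' < x - b" by blast
    define a where "a = (LEAST a. P a)"
    have "P a"
      unfolding a_def using a'(1) by (rule LeastI)
    have "a \<le> a'"
      unfolding a_def using a'(1) by (rule Least_le)
    have gaps: "{real s - b..<real s} \<inter> real ` A \<noteq> {}"
      if "s \<in> A" "3 * b < real s" "real s < real a" for s
      using that not_less_Least[of s P] by (auto simp: P_def a_def)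
    have a: "a \<in> A" "3 * b < real a" "real a + b < x"
      using \<open>P a\<close> \<open>a \<le> a'\<close> a'(2) by (auto simp: P_def)
    obtain m e where e: "real m \<le> b" "e \<in> A" "b < real e" "e \<le> 2 * m"
      using last[OF b(1)] by metis
    have "real a0 < real a"
      using a b(1) \<open>b > 0\<close> by linarith
    \<comment> \<open>With the cut-off \<open>a - 1\<close>, integrality turns
      \<open>a - 1 < d\<close> into \<open>a\<close> \<le> \<open>d\<close>, hence \<open>a\<close>
      \<le> \<open>2 * p\<close>.\<close>
    then have "real a0 \<le> real (a - 1)"
      by simp
    then obtain p d where p: "p \<in> A" "real p \<le> real (a - 1)" "real (a - 1) < real d" "d \<le> 2 * p"
      using last by metis
    have pa: "p < a" "a \<le> 2 * p"
      using p a \<open>b > 0\<close> by auto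
    let ?C = "{b<..real a + b} \<inter> real ` A"
    have "real (card ?C) \<ge> (real a + b) / (2 * b) - 1"
    proof (cases "real p \<le> 2 * b")
      \<comment> \<open>Here \<open>a\<close> \<le> \<open>4 * b\<close>, so the two elements
        \<open>e\<close> \<le> \<open>2 * b\<close> and \<open>a\<close> suffice.\<close>
      case True
      have "card {real e, real a} \<le> card ?C"
        using e a \<open>b > 0\<close> by (intro card_mono finite_nats_in_real_interval) auto
      moreover have "real e \<noteq> real a"
        using e a \<open>b > 0\<close> by linarith
      moreover have "(real a + b) / (2 * b) \<le> 3"
        using pa True \<open>b > 0\<close> by (simp add: divide_simps)
      ultimately show ?thesis by simp
    next
      case False
      let ?D = "{2 * b<..real p} \<inter> real ` A"
      \<comment> \<open>The elements \<open>e\<close> and \<open>a\<close> lie on either side of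
        \<open>(2b, p]\<close> and make up for the \<open>- 2\<close> in the walk bound.\<close>
      have "card (insert (real e) (insert (real a) ?D)) \<le> card ?C"
        using e a pa \<open>b > 0\<close> by (intro card_mono finite_nats_in_real_interval) auto
      moreover have "real e \<notin> insert (real a) ?D" "real a \<notin> ?D"
        using e a pa \<open>b > 0\<close> by auto
      ultimately have "card ?D + 2 \<le> card ?C"
        by (simp add: finite_nats_in_real_interval del: insert_iff)
      moreover have "real (card ?D) \<ge> real p / b - 2"
        using p False pa by (intro card_ge_of_short_gaps[OF \<open>b > 0\<close>, where T = "real a"] gaps) auto
      moreover have "(real a + b) / (2 * b) - 1 \<le> real p / b"
        using of_nat_mono[OF pa(2), where 'a = real] \<open>b > 0\<close>
        by (simp add: diff_le_eq pos_divide_le_eq distrib_right)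
      ultimately show ?thesis by linarith
    qed
    then show "\<exists>a\<in>A. real a > 3 * b \<and> real a + b < x \<and>
        {real a - b..<real a} \<inter> real ` A = {} \<and>
        real (card ({b<..real a + b} \<inter> real ` A)) \<ge> (real a + b) / (2 * b) - 1"
      using a \<open>P a\<close> unfolding P_def by blast
  qed
qed

end
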